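(* Consider the one-hop wireless network model described in the context, where the channel powers $\gamma_{i,j}$ are i.i.d. with the Gamma distribution (Nakagami-$m$ fading) with p.d.f. $f(x)=x^{m-1}\frac{e^{-mx/\Omega}}{\Gamma(m)(\Omega/m)^m}$ for $x\ge0$, with parameters $m,\Omega>0$. Then the throughput of one-hop schemes is of order $\Theta(\log n)$ with high probability: the maximum over all active sets $\mathbb{S}\subset\{S_1,\dots,S_n\}$ of $T(\mathbb{S})$ is $\Theta(\log n)$.
   Context: Network model: $n$ sources $S_1,\dots,S_n$ and $n$ destinations $D_1,\dots,D_n$; $S_i$ wishes to communicate with $D_i$ in one hop. The channel power from $S_i$ to $D_j$ is $\gamma_{i,j}\ge0$; all $\gamma_{i,j}$ are i.i.d. with mean $\mu$. A subset $\mathbb{S}$ of sources is active, each with power $1$ (the others silent); $SINR_i=\frac{\gamma_{i,i}}{N_0+\sum_{S_k\in\mathbb{S},k\ne i}\gamma_{k,i}}$ for $S_i\in\mathbb{S}$ (and $0$ otherwise), with noise variance $N_0\ge0$; $D_i$ succeeds if $SINR_i>\beta$ for a fixed constant $\beta>0$. The throughput $T(\mathbb{S})$ is the number of successful destinations. Logarithms are natural. "With high probability" means with probability tending to $1$ as $n\to\infty$. *)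

theory Defs
  imports "HOL-Probability.Probability"
begin

definition gamma_pdf :: "real \<Rightarrow> real \<Rightarrow> real \<Rightarrow> real" where
  "gamma_pdf m \<Omega> x =
     (if 0 \<le> x then x powr (m - 1) * exp (- m * x / \<Omega>) / (Gamma m * (\<Omega> / m) powr m) else 0)"

definition gamma_measure :: "real \<Rightarrow> real \<Rightarrow> real measure" where
  "gamma_measure m \<Omega> = density lborel (\<lambda>x. ennreal (gamma_pdf m \<Omega> x))"

definition channel_measure :: "real \<Rightarrow> real \<Rightarrow> nat \<Rightarrow> (nat \<times> nat \<Rightarrow> real) measure" where
  "channel_measure m \<Omega> n = PiM ({..<n} \<times> {..<n}) (\<lambda>_. gamma_measure m \<Omega>)"

text \<open>Destination i succeeds (SINR_i > beta) when S is the active set.  Written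
  multiplicatively so that a zero denominator (N0 = 0, no interferers) means SINR = infinity.\<close>
definition success :: "real \<Rightarrow> real \<Rightarrow> (nat \<times> nat \<Rightarrow> real) \<Rightarrow> nat set \<Rightarrow> nat \<Rightarrow> bool" where
  "success N0 \<beta> g S i \<longleftrightarrow>
     i \<in> S \<and> g (i, i) > \<beta> * (N0 + (\<Sum>k\<in>S - {i}. g (k, i)))"

definition throughput :: "real \<Rightarrow> real \<Rightarrow> (nat \<times> nat \<Rightarrow> real) \<Rightarrow> nat set \<Rightarrow> nat" where
  "throughput N0 \<beta> g S = card {i \<in> S. success N0 \<beta> g S i}"

definition max_throughput :: "real \<Rightarrow> real \<Rightarrow> nat \<Rightarrow> (nat \<times> nat \<Rightarrow> real) \<Rightarrow> nat" where
  "max_throughput N0 \<beta> n g = Max ((\<lambda>S. throughput N0 \<beta> g S) ` Pow {..<n})"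

end

theory Submission
  imports Defs "HOL-Real_Asymp.Real_Asymp"
begin

text \<open>
  All probability estimates are Chernoff bounds for products of independent coordinates, and the
  only features of the fading law that matter are a finite exponential moment and a tail
  that decays at most exponentially.

  Upper bound: since channel powers are nonnegative, silencing the unsuccessful sources keeps the
  successful ones successful, so throughput at least \<open>k\<close> yields a set \<open>A\<close> of size \<open>k\<close> all of whose
  members succeed when \<open>A\<close> is active.  The \<open>k\<close> columns of \<open>A \<times> A\<close> are independent and each
  destination succeeds with probability at most \<open>C q ^ (k - 1)\<close> for some \<open>q < 1\<close>; the union bound
  over the at most \<open>n ^ k\<close> sets gives \<open>(n C q ^ (k - 1)) ^ k\<close>, which vanishes for \<open>k = c ln n\<close>, \<open>c\<close> large.

  Lower bound: for \<open>t = a ln n\<close> with \<open>a\<close> small, polynomially many direct channels exceed \<open>t\<close>.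
  Activate \<open>k = c ln n\<close> of those sources, chosen from the diagonal alone.  The interference is
  independent of this choice, and is below \<open>\<theta> k\<close> at all \<open>k\<close> destinations except with
  probability \<open>k exp (- k)\<close>; for small \<open>c\<close> this is less than what \<open>t\<close> can tolerate.
\<close>

section \<open>Markov's inequality and union bound on product spaces\<close>

text \<open>On \<open>E\<close> some summand is at least 1, so the sum dominates the indicator of
  \<open>E\<close>; independence then factors the integral of each summand. All Chernoff estimates
  below are instances, with \<open>J a\<close> the coordinates that witness \<open>a\<close> looks
  at.\<close>

lemma emeasure_PiM_le_sum_prod:
  fixes f :: "'a \<Rightarrow> 'i \<Rightarrow> 'b \<Rightarrow> ennreal"
  assumes I: "finite I" and K: "finite K" and M: "\<And>p. prob_space (M p)"
    and J: "\<And>a. a \<in> K \<Longrightarrow> J a \<subseteq> I"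
    and f: "\<And>a p. a \<in> K \<Longrightarrow> p \<in> J a \<Longrightarrow> f a p \<in> borel_measurable (M p)"
    and E: "AE g in PiM I M. g \<in> E \<longrightarrow> (\<exists>a\<in>K. 1 \<le> c a * (\<Prod>p\<in>J a. f a p (g p)))"
  shows "emeasure (PiM I M) E \<le> (\<Sum>a\<in>K. c a * (\<Prod>p\<in>J a. \<integral>\<^sup>+x. f a p x \<partial>M p))"
proof (cases "E \<in> sets (PiM I M)")
  case True
  interpret product_sigma_finite M
    using M by (simp add: product_sigma_finite_def prob_space_imp_sigma_finite)
  have f_comp[measurable]: "(\<lambda>g. f a p (g p)) \<in> borel_measurable (PiM I M)"
    if "a \<in> K" "p \<in> J a" for a p
  proof -
    have [measurable]: "p \<in> I" "f a p \<in> borel_measurable (M p)" using that f J by auto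
    show ?thesis by measurable
  qed
  have prod_J: "(\<integral>\<^sup>+g. (\<Prod>p\<in>J a. f a p (g p)) \<partial>PiM I M) = (\<Prod>p\<in>J a. \<integral>\<^sup>+x. f a p x \<partial>M p)"
    if a: "a \<in> K" for a
  proof -
    \<comment> \<open>Padding with the constant 1 extends the product from \<open>J a\<close> to all
      of \<open>I\<close>; the added factors integrate to 1 because each \<open>M p\<close> is a
      probability space.\<close>
    define h where "h p = (if p \<in> J a then f a p else (\<lambda>_. 1))" for p
    have "(\<Prod>p\<in>J a. f a p (g p)) = (\<Prod>p\<in>I. h p (g p))" for g
      using I J[OF a] by (intro prod.mono_neutral_cong_left) (auto simp: h_def)
    then have "(\<integral>\<^sup>+g. (\<Prod>p\<in>J a. f a p (g p)) \<partial>PiM I M) = (\<Prod>p\<in>I. \<integral>\<^sup>+x. h p x \<partial>M p)"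
      using I f[OF a] by (subst product_nn_integral_prod[symmetric]) (auto simp: h_def)
    also have "\<dots> = (\<Prod>p\<in>J a. \<integral>\<^sup>+x. f a p x \<partial>M p)"
      using I J[OF a]
      by (intro prod.mono_neutral_cong_right) (auto simp: h_def prob_space.emeasure_space_1[OF M])
    finally show ?thesis .
  qed
  have "emeasure (PiM I M) E = (\<integral>\<^sup>+g. indicator E g \<partial>PiM I M)"
    using True by simp
  also have "\<dots> \<le> (\<integral>\<^sup>+g. (\<Sum>a\<in>K. c a * (\<Prod>p\<in>J a. f a p (g p))) \<partial>PiM I M)"
  proof (rule nn_integral_mono_AE, use E in eventually_elim)
    case (elim g)
    show ?case
    proof (cases "g \<in> E")
      case True
      with elim obtain a where a: "a \<in> K" and 1: "1 \<le> c a * (\<Prod>p\<in>J a. f a p (g p))" by blast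
      note 1
      also have "\<dots> \<le> (\<Sum>a\<in>K. c a * (\<Prod>p\<in>J a. f a p (g p)))"
        using a K by (intro member_le_sum) auto
      finally show ?thesis using True by simp
    qed simp
  qed
  also have "\<dots> = (\<Sum>a\<in>K. c a * (\<Prod>p\<in>J a. \<integral>\<^sup>+x. f a p x \<partial>M p))"
    by (subst nn_integral_sum) (auto intro!: sum.cong simp: nn_integral_cmult prod_J f_comp borel_measurable_prod)
  finally show ?thesis .
qed (simp add: emeasure_notin_sets)

section \<open>Measurability of throughput for i.i.d. links with law \<open>D\<close>\<close>

locale iid_channel = prob_space D for D :: "real measure" +
  assumes sets_D [measurable_cong]: "sets D = sets borel"
begin

abbreviation channel :: "nat \<Rightarrow> (nat \<times> nat \<Rightarrow> real) measure" where
  "channel n \<equiv> PiM ({..<n} \<times> {..<n}) (\<lambda>_. D)"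

lemma prob_space_channel: "prob_space (channel n)"
  by (intro prob_space_PiM prob_space_axioms)

lemma channel_component_measurable [measurable]:
  "i < n \<Longrightarrow> j < n \<Longrightarrow> (\<lambda>g. g (i, j)) \<in> borel_measurable (channel n)"
  by measurable

lemma borel_measurable_D:
  "(f \<in> borel_measurable D) = (f \<in> borel_measurable borel)" for f :: "real \<Rightarrow> ennreal"
  by (simp only: measurable_cong_sets[OF sets_D refl])

lemma throughput_measurable [measurable]:
  assumes "S \<subseteq> {..<n}"
  shows "(\<lambda>g. throughput N0 \<beta> g S) \<in> channel n \<rightarrow>\<^sub>M count_space UNIV"
proof -
  have [simp]: "finite S" using assms finite_subset by blast
  have [measurable]: "Measurable.pred (channel n) (\<lambda>g. success N0 \<beta> g S i)" if "i \<in> S" for i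
  proof -
    have "(\<lambda>g. \<Sum>k\<in>S - {i}. g (k, i)) \<in> borel_measurable (channel n)"
      using assms that by (intro borel_measurable_sum channel_component_measurable) auto
    moreover have "(\<lambda>g. g (i, i)) \<in> borel_measurable (channel n)"
      using assms that by (intro channel_component_measurable) auto
    ultimately show ?thesis using that unfolding success_def by simp
  qed
  have "throughput N0 \<beta> g S = (\<Sum>i\<in>S. if success N0 \<beta> g S i then 1 else 0)" for g
    by (simp add: throughput_def sum.inter_filter[symmetric])
  then show ?thesis by simp
qed

lemma sets_low_throughput [measurable]:
  "{g \<in> space (channel n). \<forall>S\<subseteq>{..<n}. throughput N0 \<beta> g S < k} \<in> sets (channel n)"
proof -
  have "Measurable.pred (channel n) (\<lambda>g. \<forall>S\<in>Pow {..<n}. throughput N0 \<beta> g S < k)"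
    by (intro pred_intros_finite) simp_all
  then show ?thesis by (simp add: pred_def Ball_def)
qed

lemma sets_high_throughput [measurable]:
  "{g \<in> space (channel n). \<exists>S\<subseteq>{..<n}. k \<le> throughput N0 \<beta> g S} \<in> sets (channel n)"
proof -
  have "Measurable.pred (channel n) (\<lambda>g. \<exists>S\<in>Pow {..<n}. k \<le> throughput N0 \<beta> g S)"
    by (intro pred_intros_finite) simp_all
  then show ?thesis by (simp add: pred_def Bex_def)
qed

text \<open>A maximum equals \<open>a\<close> iff \<open>a\<close> is attained and is an upper
  bound, which is a finite combination of measurable throughput events; as \<open>nat\<close> is
  countable, preimages of singletons suffice.\<close>

lemma max_throughput_measurable [measurable]:
  "max_throughput N0 \<beta> n \<in> channel n \<rightarrow>\<^sub>M count_space UNIV"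
proof -
  have "max_throughput N0 \<beta> n -` {a} \<inter> space (channel n) \<in> sets (channel n)" for a
  proof -
    have iff: "max_throughput N0 \<beta> n g = a \<longleftrightarrow>
        (\<exists>S\<in>Pow {..<n}. throughput N0 \<beta> g S = a) \<and> (\<forall>S\<in>Pow {..<n}. throughput N0 \<beta> g S \<le> a)" for g
      unfolding max_throughput_def by (subst Max_eq_iff) auto
    have "max_throughput N0 \<beta> n -` {a} \<inter> space (channel n) = {g \<in> space (channel n).
        (\<exists>S\<in>Pow {..<n}. throughput N0 \<beta> g S = a) \<and> (\<forall>S\<in>Pow {..<n}. throughput N0 \<beta> g S \<le> a)}"
      using iff by auto
    moreover have "Measurable.pred (channel n) (\<lambda>g. (\<exists>S\<in>Pow {..<n}. throughput N0 \<beta> g S = a)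
        \<and> (\<forall>S\<in>Pow {..<n}. throughput N0 \<beta> g S \<le> a))"
      by (intro pred_intros_logic pred_intros_finite) simp_all
    ultimately show ?thesis by (simp add: pred_def)
  qed
  then show ?thesis by (simp add: measurable_count_space_eq2_countable)
qed

section \<open>Exponential bound against large throughput\<close>

text \<open>Used with \<open>a = 1 - exp (-1)\<close> to count strong direct links, and with
  \<open>a = 1 - exp (- s * \<beta>)\<close> to get the factor \<open>q < 1\<close> of an
  interfering link.\<close>

lemma nn_integral_one_minus_indicator:
  assumes "0 \<le> a" "a \<le> 1"
  shows "(\<integral>\<^sup>+x. ennreal (1 - a * indicator {t<..} x) \<partial>D) = ennreal (1 - a * prob {t<..})"
proof -
  have [measurable]: "{t<..} \<in> sets D" by (simp add: sets_D)
  have int: "integrable D (\<lambda>x. a * indicator {t<..} x :: real)"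
    by (intro integrable_mult_right integrable_real_indicator) (auto simp: emeasure_eq_measure)
  have "(\<integral>\<^sup>+x. ennreal (1 - a * indicator {t<..} x) \<partial>D) = ennreal (expectation (\<lambda>x. 1 - a * indicator {t<..} x))"
    using assms
    by (intro nn_integral_eq_integral Bochner_Integration.integrable_diff int) (auto simp: indicator_def)
  also have "expectation (\<lambda>x. 1 - a * indicator {t<..} x) = 1 - a * prob {t<..}"
    by (subst Bochner_Integration.integral_diff[OF _ int]) (auto simp: prob_space)
  finally show ?thesis .
qed

text \<open>Success of \<open>i\<close> within \<open>A\<close> makes
  \<open>exp (s * (signal - \<beta> * interference))\<close> at least 1. Multiplied over
  \<open>i\<close> in \<open>A\<close>, this has one factor per coordinate of
  \<open>A \<times> A\<close>: each of the \<open>k\<close> columns contributes \<open>C\<close>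
  once and \<open>q\<close> exactly \<open>k - 1\<close> times. The factor \<open>n ^ k\<close>
  bounds the number of sets \<open>A\<close>.\<close>

lemma emeasure_large_throughput_le:
  assumes nonneg: "AE x in D. 0 \<le> x" and s: "s > 0" and \<beta>: "\<beta> > 0" and N0: "N0 \<ge> 0"
    and C: "(\<integral>\<^sup>+x. ennreal (exp (s * x)) \<partial>D) \<le> ennreal C" "C \<ge> 0"
    and q: "(\<integral>\<^sup>+x. ennreal (exp (- s * \<beta> * x)) \<partial>D) \<le> ennreal q" "q \<ge> 0"
  shows "emeasure (channel n) {g \<in> space (channel n). \<exists>S\<subseteq>{..<n}. k \<le> throughput N0 \<beta> g S}
           \<le> ennreal ((real n * C * q ^ (k - 1)) ^ k)"
proof -
  let ?I = "{..<n} \<times> {..<n}"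
  let ?K = "{A. A \<subseteq> {..<n} \<and> card A = k}"
  \<comment> \<open>Diagonal coordinates carry the signal, off-diagonal ones the interference; the
    integrals are bounded by \<open>C\<close> and \<open>q\<close> respectively.\<close>
  define f where "f p x = ennreal (exp (if fst p = snd p then s * x else - s * \<beta> * x))" for p :: "nat \<times> nat" and x
  have f_meas: "f p \<in> borel_measurable D" for p
    unfolding f_def[abs_def] borel_measurable_D by (cases "fst p = snd p") simp_all
  have fin: "finite A" if "A \<in> ?K" for A using that finite_subset by auto
  have "AE g in channel n. \<forall>p\<in>?I. 0 \<le> g p"
    by (intro AE_finite_allI AE_PiM_component nonneg prob_space_axioms) auto
  then have ae: "AE g in channel n.
      g \<in> {g \<in> space (channel n). \<exists>S\<subseteq>{..<n}. k \<le> throughput N0 \<beta> g S} \<longrightarrow>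
      (\<exists>A\<in>?K. 1 \<le> 1 * (\<Prod>p\<in>A \<times> A. f p (g p)))"
  proof (eventually_elim, safe)
    fix g S assume g: "\<forall>p\<in>?I. 0 \<le> g p" and S: "S \<subseteq> {..<n}" "k \<le> throughput N0 \<beta> g S"
    obtain A where A: "A \<subseteq> {i \<in> S. success N0 \<beta> g S i}" "card A = k" "finite A"
      using S(2) unfolding throughput_def by (rule obtain_subset_with_card_n)
    have finS: "finite S" using S finite_subset by blast
    have "0 \<le> s * g (i, i) + (\<Sum>j\<in>A - {i}. - s * \<beta> * g (j, i))" if i: "i \<in> A" for i
    proof -
      \<comment> \<open>Shrinking the active set from \<open>S\<close> to \<open>A\<close> only
        lowers the interference, since powers are nonnegative.\<close>
      have "(\<Sum>j\<in>A - {i}. g (j, i)) \<le> (\<Sum>j\<in>S - {i}. g (j, i))"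
        using A S i g finS by (intro sum_mono2) (auto simp: subset_eq)
      also have "\<dots> \<le> N0 + (\<Sum>j\<in>S - {i}. g (j, i))" using N0 by simp
      finally have le: "(\<Sum>j\<in>A - {i}. g (j, i)) \<le> N0 + (\<Sum>j\<in>S - {i}. g (j, i))" .
      have "\<beta> * (\<Sum>j\<in>A - {i}. g (j, i)) \<le> g (i, i)"
        (is "\<beta> * ?a \<le> _")
      proof -
        have "success N0 \<beta> g S i" using A(1) i by auto
        then have "\<beta> * (N0 + (\<Sum>j\<in>S - {i}. g (j, i))) < g (i, i)" by (simp add: success_def)
        moreover have "\<beta> * ?a \<le> \<beta> * (N0 + (\<Sum>j\<in>S - {i}. g (j, i)))"
          using \<beta> le by (intro mult_left_mono) auto
        ultimately show ?thesis by linarith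
      qed
      then have "s * (\<beta> * (\<Sum>j\<in>A - {i}. g (j, i))) \<le> s * g (i, i)"
        using s by (intro mult_left_mono) auto
      then show ?thesis by (simp add: sum_negf sum_distrib_left mult.assoc)
    qed
    then have "ennreal 1 \<le> (\<Prod>i\<in>A. ennreal (exp (s * g (i, i) + (\<Sum>j\<in>A - {i}. - s * \<beta> * g (j, i)))))"
      by (auto simp del: ennreal_1 simp add: prod_ennreal intro!: ennreal_leI prod_ge_1)
    also have "\<dots> = (\<Prod>i\<in>A. \<Prod>j\<in>A. f (j, i) (g (j, i)))"
    proof (rule prod.cong[OF refl])
      fix i assume i: "i \<in> A"
      have "(\<Prod>j\<in>A. f (j, i) (g (j, i))) = f (i, i) (g (i, i)) * (\<Prod>j\<in>A - {i}. f (j, i) (g (j, i)))"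
        using A i by (intro prod.remove) auto
      also have "(\<Prod>j\<in>A - {i}. f (j, i) (g (j, i))) = (\<Prod>j\<in>A - {i}. ennreal (exp (- s * \<beta> * g (j, i))))"
        by (intro prod.cong) (auto simp: f_def)
      finally show "ennreal (exp (s * g (i, i) + (\<Sum>j\<in>A - {i}. - s * \<beta> * g (j, i)))) = (\<Prod>j\<in>A. f (j, i) (g (j, i)))"
        using A by (simp add: f_def exp_add exp_sum prod_ennreal prod_nonneg ennreal_mult del: mult_minus_left)
    qed
    also have "\<dots> = (\<Prod>p\<in>A \<times> A. f p (g p))"
      by (subst prod.swap) (simp add: prod.cartesian_product)
    finally show "\<exists>A\<in>?K. 1 \<le> 1 * (\<Prod>p\<in>A \<times> A. f p (g p))"
      using A S by (intro bexI[of _ A]) auto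
  qed
  have "emeasure (channel n) {g \<in> space (channel n). \<exists>S\<subseteq>{..<n}. k \<le> throughput N0 \<beta> g S}
      \<le> (\<Sum>A\<in>?K. 1 * (\<Prod>p\<in>A \<times> A. \<integral>\<^sup>+x. f p x \<partial>D))"
    using ae by (intro emeasure_PiM_le_sum_prod prob_space_axioms) (auto simp: f_meas)
  also have "\<dots> \<le> (\<Sum>A\<in>?K. ennreal ((C * q ^ (k - 1)) ^ k))"
  proof (rule sum_mono)
    fix A assume A: "A \<in> ?K"
    have "(\<Prod>p\<in>A \<times> A. \<integral>\<^sup>+x. f p x \<partial>D) \<le> (\<Prod>p\<in>A \<times> A. ennreal (if fst p = snd p then C else q))"
      using C q by (intro prod_mono_ennreal) (auto simp: f_def)
    also have "\<dots> = ennreal (\<Prod>i\<in>A. \<Prod>j\<in>A. if i = j then C else q)"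
      using C q by (simp add: prod_ennreal prod.cartesian_product case_prod_beta)
    also have "(\<Prod>i\<in>A. \<Prod>j\<in>A. if i = j then C else q) = (\<Prod>i\<in>A. C * q ^ (k - 1))"
    proof (rule prod.cong[OF refl])
      fix i assume i: "i \<in> A"
      have "(\<Prod>j\<in>A. if i = j then C else q) = C * (\<Prod>j\<in>A - {i}. if i = j then C else q)"
        using fin[OF A] i by (subst prod.remove[of _ i]) auto
      also have "(\<Prod>j\<in>A - {i}. if i = j then C else q) = (\<Prod>j\<in>A - {i}. q)"
        by (intro prod.cong) auto
      finally show "(\<Prod>j\<in>A. if i = j then C else q) = C * q ^ (k - 1)"
        using A i fin[OF A] by (simp add: card_Diff_singleton)
    qed
    finally show "1 * (\<Prod>p\<in>A \<times> A. \<integral>\<^sup>+x. f p x \<partial>D) \<le> ennreal ((C * q ^ (k - 1)) ^ k)"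
      using A by simp
  qed
  also have "\<dots> = ennreal (real (n choose k) * (C * q ^ (k - 1)) ^ k)"
    using C q by (simp add: n_subsets ennreal_mult ennreal_of_nat_eq_real_of_nat)
  also have "\<dots> \<le> ennreal (real n ^ k * (C * q ^ (k - 1)) ^ k)"
  proof -
    have "n choose k \<le> n ^ k" by (cases "k \<le> n") (auto simp: binomial_le_pow binomial_eq_0)
    then have "real (n choose k) \<le> real n ^ k" by (metis of_nat_le_iff of_nat_power)
    then show ?thesis using C q by (intro ennreal_leI mult_right_mono) auto
  qed
  finally show ?thesis by (simp add: power_mult_distrib mult.assoc)
qed

section \<open>Exponential bound against small throughput\<close>

text \<open>There are two ways to fail. Either fewer than \<open>k\<close> direct links exceed
  \<open>t\<close> (first term, a lower binomial tail), or one of \<open>k\<close> selected sources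
  fails despite a signal above \<open>t\<close>. By the choice of \<open>t\<close> its interference
  is then at least \<open>\<theta> * k\<close>, which gives the second term.\<close>

lemma emeasure_small_throughput_le:
  assumes s: "s > 0" and \<beta>: "\<beta> > 0"
    and C: "(\<integral>\<^sup>+x. ennreal (exp (s * x)) \<partial>D) \<le> ennreal C" "C \<ge> 1"
    and t: "\<beta> * (N0 + \<theta> * real k) \<le> t"
  shows "emeasure (channel n) {g \<in> space (channel n). \<forall>S\<subseteq>{..<n}. throughput N0 \<beta> g S < k}
           \<le> ennreal (exp (real k - real n * prob {t<..} * (1 - exp (-1)))
                 + real k * (C * exp (- s * \<theta>)) ^ k)"
proof -
  define L where "L g = {i \<in> {..<n}. t < g (i, i)}" for g :: "nat \<times> nat \<Rightarrow> real"
  define few where "few = {g \<in> space (channel n). card (L g) < k}"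
  have [measurable]: "{t<..} \<in> sets D" "{..t} \<in> sets D" by (auto simp: sets_D)
  have inj: "inj_on (\<lambda>i. (i, i)) X" for X :: "nat set" by (auto simp: inj_on_def)
  have few_sets: "few \<in> sets (channel n)"
  proof -
    have "card (L g) = (\<Sum>i<n. if t < g (i, i) then 1 else 0)" for g
      by (simp add: L_def sum.inter_filter[symmetric])
    then show ?thesis unfolding few_def by simp
  qed
  have few_le: "emeasure (channel n) few \<le> ennreal (exp (real k - real n * prob {t<..} * (1 - exp (-1))))"
  proof -
    \<comment> \<open>Each strong link contributes \<open>exp (-1)\<close>, so the product is
      \<open>exp (- card (L g))\<close>, at least \<open>exp (- k)\<close> on
      \<open>few\<close>.\<close>
    let ?f = "\<lambda>p x. ennreal (if t < x then exp (-1) else 1)"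
    have mgf: "(\<integral>\<^sup>+x. ?f () x \<partial>D) \<le> ennreal (exp (- (prob {t<..} * (1 - exp (-1)))))"
    proof -
      have "(\<integral>\<^sup>+x. ?f () x \<partial>D) = (\<integral>\<^sup>+x. ennreal (1 - (1 - exp (-1)) * indicator {t<..} x) \<partial>D)"
        by (intro nn_integral_cong) (simp add: indicator_def)
      also have "\<dots> = ennreal (1 - (1 - exp (-1)) * prob {t<..})"
        by (rule nn_integral_one_minus_indicator) auto
      \<comment> \<open>This is \<open>1 - y \<le> exp (- y)\<close>.\<close>
      also have "1 - (1 - exp (-1)) * prob {t<..} \<le> exp (- (prob {t<..} * (1 - exp (-1))))"
        using exp_ge_add_one_self[of "- (prob {t<..} * (1 - exp (-1)))"] by (simp add: mult.commute)
      finally show ?thesis by (simp add: ennreal_leI)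
    qed
    have "emeasure (channel n) few
        \<le> (\<Sum>u\<in>{()}. ennreal (exp k) * (\<Prod>p\<in>(\<lambda>i. (i, i)) ` {..<n}. \<integral>\<^sup>+x. ?f p x \<partial>D))"
    proof (rule emeasure_PiM_le_sum_prod, goal_cases)
      case 6
      show ?case
      proof (intro AE_I2 impI bexI[of _ "()"])
        fix g assume "g \<in> few"
        then have k: "card (L g) \<le> k" by (simp add: few_def)
        have "(\<Prod>p\<in>(\<lambda>i. (i, i)) ` {..<n}. ?f p (g p)) = ennreal (\<Prod>i<n. if t < g (i, i) then exp (-1) else 1)"
          by (subst prod.reindex[OF inj]) (simp add: prod_ennreal)
        also have "(\<Prod>i<n. if t < g (i, i) then exp (-1) else 1 :: real) = exp (- real (card (L g)))"
          by (simp add: L_def prod.inter_filter[symmetric] exp_of_nat_mult[symmetric])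
        finally show "1 \<le> ennreal (exp k) * (\<Prod>p\<in>(\<lambda>i. (i, i)) ` {..<n}. ?f p (g p))"
          using k by (simp add: ennreal_mult'[symmetric] exp_add[symmetric] flip: ennreal_1)
      qed simp
    qed (auto simp: prob_space_axioms)
    also have "\<dots> = ennreal (exp k) * (\<integral>\<^sup>+x. ?f () x \<partial>D) ^ n"
      by (simp add: card_image[OF inj])
    also have "\<dots> \<le> ennreal (exp k) * ennreal (exp (- (prob {t<..} * (1 - exp (-1))))) ^ n"
      by (intro mult_left_mono power_mono mgf) auto
    also have "\<dots> = ennreal (exp (real k - real n * prob {t<..} * (1 - exp (-1))))"
      by (simp add: ennreal_power ennreal_mult'[symmetric] exp_of_nat_mult[symmetric] exp_add[symmetric]
          algebra_simps)
    finally show ?thesis .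
  qed
  \<comment> \<open>A fixed selection of \<open>k\<close> elements from every large enough
    \<open>M\<close>: the active set \<open>A (L g)\<close> then depends on the diagonal of
    \<open>g\<close> alone.\<close>
  have "\<exists>A. k \<le> card M \<longrightarrow> A \<subseteq> M \<and> card A = k" for M :: "nat set"
    by (meson obtain_subset_with_card_n)
  then have "\<exists>A. \<forall>M :: nat set. k \<le> card M \<longrightarrow> A M \<subseteq> M \<and> card (A M) = k"
    by (intro choice allI)
  then obtain A where A: "k \<le> card M \<Longrightarrow> A M \<subseteq> M \<and> card (A M) = k" for M :: "nat set" by blast
  have finA: "finite (A M)" if "M \<subseteq> {..<n}" "k \<le> card M" for M
    using A[OF that(2)] that(1) by (meson finite_lessThan finite_subset)
  let ?low = "{g \<in> space (channel n). \<forall>S\<subseteq>{..<n}. throughput N0 \<beta> g S < k}"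
  let ?K = "SIGMA M:{M. M \<subseteq> {..<n} \<and> k \<le> card M}. A M"
  \<comment> \<open>The product of \<open>w M j\<close> over \<open>j < n\<close> is the probability
    that \<open>L g = M\<close>.\<close>
  define w where "w M i = ennreal (prob (if i \<in> M then {t<..} else {..t}))" for M and i :: nat
  \<comment> \<open>The union bound runs over the possible values \<open>M\<close> of \<open>L g\<close>; the event \<open>L g = M\<close> is itself a product
    of indicators of diagonal coordinates, so conditioning on the diagonal is not needed.\<close>
  have interf: "emeasure (channel n) (?low - few) \<le> ennreal (real k * (C * exp (- s * \<theta>)) ^ k)"
  proof -
    \<comment> \<open>The whole diagonal tests \<open>L g = M\<close>; the disjoint column part
      holds the interferers of destination \<open>i\<close>.\<close>
    define J where "J = (\<lambda>(M, i). (\<lambda>i. (i, i)) ` {..<n} \<union> (A M - {i}) \<times> {i})"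
    define f where "f = (\<lambda>(M :: nat set, i :: nat) p x. if fst p = snd p
        then indicator (if fst p \<in> M then {t<..} else {..t}) x else ennreal (exp (s * x)))"
    have prod_J: "(\<Prod>p\<in>J (M, i). h p) = (\<Prod>j<n. h (j, j)) * (\<Prod>j\<in>A M - {i}. h (j, i))"
      if "(M, i) \<in> ?K" for M i and h :: "nat \<times> nat \<Rightarrow> ennreal"
    proof -
      have "finite (A M)" using that finA by auto
      moreover have "(A M - {i}) \<times> {i} = (\<lambda>j. (j, i)) ` (A M - {i})" by auto
      ultimately show ?thesis unfolding J_def prod.case
        by (subst prod.union_disjoint) (auto simp: prod.reindex[OF inj] prod.reindex inj_on_def)
    qed
    have "emeasure (channel n) (?low - few)
        \<le> (\<Sum>a\<in>?K. ennreal (exp (- s * \<theta> * k)) * (\<Prod>p\<in>J a. \<integral>\<^sup>+x. f a p x \<partial>D))"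
    proof (rule emeasure_PiM_le_sum_prod, goal_cases)
      case 2
      have "finite {M. M \<subseteq> {..<n} \<and> k \<le> card M}" by (rule finite_subset[of _ "Pow {..<n}"]) auto
      then show ?case using finA by (intro finite_SigmaI) auto
    next
      case (4 a)
      then obtain M i where a: "a = (M, i)" "M \<subseteq> {..<n}" "k \<le> card M" "i \<in> A M" by blast
      then have "A M \<subseteq> {..<n}" using A[of M] by blast
      then show ?case using a by (auto simp: J_def)
    next
      case (5 a p)
      show ?case unfolding borel_measurable_D
        by (cases a; cases "fst p = snd p") (auto simp: f_def[abs_def])
    next
      case 6
      show ?case
      proof (intro AE_I2 impI)
        fix g assume g: "g \<in> ?low - few"
        have L: "L g \<subseteq> {..<n}" "k \<le> card (L g)" using g by (auto simp: few_def L_def)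
        note AL = A[OF L(2)]
        have "throughput N0 \<beta> g (A (L g)) < k" using g AL L by auto
        then have "{i \<in> A (L g). success N0 \<beta> g (A (L g)) i} \<noteq> A (L g)"
          using AL unfolding throughput_def by force
        then obtain i where i: "i \<in> A (L g)" "\<not> success N0 \<beta> g (A (L g)) i" by blast
        \<comment> \<open>The signal of the failing \<open>i\<close> exceeds \<open>t\<close>, so
          only the interference can be to blame.\<close>
        have "t < g (i, i)" using i AL by (auto simp: L_def)
        then have "\<beta> * (N0 + \<theta> * real k) < \<beta> * (N0 + (\<Sum>j\<in>A (L g) - {i}. g (j, i)))"
          using i t by (auto simp: success_def)
        then have "\<theta> * real k \<le> (\<Sum>j\<in>A (L g) - {i}. g (j, i))" using \<beta> by simp
        then have "s * (\<theta> * real k) \<le> s * (\<Sum>j\<in>A (L g) - {i}. g (j, i))" using s by simp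
        then have "ennreal 1 \<le> ennreal (exp (- s * \<theta> * k) * exp (\<Sum>j\<in>A (L g) - {i}. s * g (j, i)))"
          by (intro ennreal_leI) (simp add: exp_add[symmetric] sum_distrib_left mult.assoc)
        moreover have K: "(L g, i) \<in> ?K" using L i by auto
        moreover have "(\<Prod>p\<in>J (L g, i). f (L g, i) p (g p)) = ennreal (exp (\<Sum>j\<in>A (L g) - {i}. s * g (j, i)))"
        proof -
          have "finite (A (L g))" using L by (rule finA)
          moreover have "(\<Prod>j<n. f (L g, i) (j, j) (g (j, j))) = 1"
            by (intro prod.neutral) (auto simp: f_def L_def)
          moreover have "(\<Prod>j\<in>A (L g) - {i}. f (L g, i) (j, i) (g (j, i)))
              = (\<Prod>j\<in>A (L g) - {i}. ennreal (exp (s * g (j, i))))"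
            by (intro prod.cong) (auto simp: f_def)
          ultimately show ?thesis unfolding prod_J[OF K] by (simp add: prod_ennreal exp_sum)
        qed
        ultimately show "\<exists>a\<in>?K. 1 \<le> ennreal (exp (- s * \<theta> * k)) * (\<Prod>p\<in>J a. f a p (g p))"
          by (intro bexI[of _ "(L g, i)"]) (simp_all add: ennreal_mult)
      qed
    qed (auto simp: prob_space_axioms)
    also have "\<dots> \<le> (\<Sum>a\<in>?K. (\<Prod>j<n. w (fst a) j) * ennreal ((C * exp (- s * \<theta>)) ^ k))"
    proof (rule sum_mono, safe)
      fix M i assume M: "M \<subseteq> {..<n}" "k \<le> card M" and i: "i \<in> A M"
      have K: "(M, i) \<in> ?K" using M i by auto
      have card: "card (A M - {i}) = k - 1" using A[OF M(2)] i by (metis card_Diff_singleton)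
      have "(\<Prod>j<n. \<integral>\<^sup>+x. f (M, i) (j, j) x \<partial>D) = (\<Prod>j<n. w M j)"
        by (intro prod.cong) (auto simp: f_def w_def emeasure_eq_measure)
      moreover have "(\<Prod>j\<in>A M - {i}. \<integral>\<^sup>+x. f (M, i) (j, i) x \<partial>D) \<le> ennreal (C ^ k)"
      proof -
        have "(\<Prod>j\<in>A M - {i}. \<integral>\<^sup>+x. f (M, i) (j, i) x \<partial>D) \<le> (\<Prod>j\<in>A M - {i}. ennreal C)"
          using C by (intro prod_mono_ennreal) (auto simp: f_def)
        \<comment> \<open>There are \<open>k - 1\<close> interferers; \<open>C \<ge> 1\<close>
          permits raising the exponent to \<open>k\<close>.\<close>
        also have "\<dots> \<le> ennreal (C ^ k)"
          using C by (simp add: card ennreal_power ennreal_leI power_increasing)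
        finally show ?thesis .
      qed
      ultimately have "ennreal (exp (- s * \<theta> * k)) * (\<Prod>p\<in>J (M, i). \<integral>\<^sup>+x. f (M, i) p x \<partial>D)
          \<le> ennreal (exp (- s * \<theta> * k)) * ((\<Prod>j<n. w M j) * ennreal (C ^ k))"
        unfolding prod_J[OF K] by (intro mult_left_mono mult_mono) auto
      also have "\<dots> = (\<Prod>j<n. w M j) * (ennreal (exp (- s * \<theta> * k)) * ennreal (C ^ k))"
        by (simp add: mult_ac)
      also have "ennreal (exp (- s * \<theta> * k)) * ennreal (C ^ k) = ennreal ((C * exp (- s * \<theta>)) ^ k)"
        using C by (simp add: ennreal_mult[symmetric] power_mult_distrib exp_of_nat_mult[symmetric] mult_ac)
      finally show "ennreal (exp (- s * \<theta> * k)) * (\<Prod>p\<in>J (M, i). \<integral>\<^sup>+x. f (M, i) p x \<partial>D)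
          \<le> (\<Prod>j<n. w (fst (M, i)) j) * ennreal ((C * exp (- s * \<theta>)) ^ k)" by simp
    qed
    also have "\<dots> = (\<Sum>M | M \<subseteq> {..<n} \<and> k \<le> card M. (\<Prod>j<n. w M j)) * ennreal (real k * (C * exp (- s * \<theta>)) ^ k)"
    proof -
      have "(\<Sum>a\<in>?K. (\<Prod>j<n. w (fst a) j) * ennreal ((C * exp (- s * \<theta>)) ^ k))
          = (\<Sum>M | M \<subseteq> {..<n} \<and> k \<le> card M. \<Sum>i\<in>A M. (\<Prod>j<n. w M j) * ennreal ((C * exp (- s * \<theta>)) ^ k))"
        using finA by (subst sum.Sigma) (auto simp: case_prod_beta)
      also have "\<dots> = (\<Sum>M | M \<subseteq> {..<n} \<and> k \<le> card M. (\<Prod>j<n. w M j) * ennreal (real k * (C * exp (- s * \<theta>)) ^ k))"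
        using A C by (intro sum.cong)
          (auto simp: ennreal_mult ennreal_of_nat_eq_real_of_nat[symmetric] mult_ac)
      finally show ?thesis by (simp add: sum_distrib_right)
    qed
    also have "(\<Sum>M | M \<subseteq> {..<n} \<and> k \<le> card M. (\<Prod>j<n. w M j)) \<le> 1"
    proof -
      \<comment> \<open>Over all subsets \<open>M\<close> the sum is the expansion of a product of
        \<open>n\<close> factors \<open>prob {t<..} + prob {..t} = 1\<close>.\<close>
      have "(\<Sum>M | M \<subseteq> {..<n} \<and> k \<le> card M. (\<Prod>j<n. w M j)) \<le> (\<Sum>M\<in>Pow {..<n}. (\<Prod>j<n. w M j))"
        by (intro sum_mono2) auto
      also have "\<dots> = (\<Sum>M\<in>Pow {..<n}. (\<Prod>j\<in>M. ennreal (prob {t<..})) * (\<Prod>j\<in>{..<n} - M. ennreal (prob {..t})))"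
      proof (rule sum.cong[OF refl])
        fix M assume "M \<in> Pow {..<n}"
        then have "(\<Prod>j<n. w M j) = (\<Prod>j\<in>{..<n} - M. w M j) * (\<Prod>j\<in>M. w M j)"
          by (intro prod.subset_diff) auto
        then show "(\<Prod>j<n. w M j) = (\<Prod>j\<in>M. ennreal (prob {t<..})) * (\<Prod>j\<in>{..<n} - M. ennreal (prob {..t}))"
          by (simp add: w_def mult.commute)
      qed
      also have "\<dots> = (\<Prod>j<n. ennreal (prob {t<..}) + ennreal (prob {..t}))"
        by (rule prod_add[symmetric]) simp
      also have "ennreal (prob {t<..}) + ennreal (prob {..t}) = 1"
      proof -
        have "prob {t<..} + prob {..t} = prob ({t<..} \<union> {..t})"
          by (intro finite_measure_Union[symmetric]) auto
        also have "{t<..} \<union> {..t} = space D" using sets_eq_imp_space_eq[OF sets_D] by auto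
        finally show ?thesis by (simp add: prob_space ennreal_plus[symmetric] del: ennreal_plus)
      qed
      finally show ?thesis by simp
    qed
    finally show ?thesis by (simp add: mult_right_mono)
  qed
  have low_sets: "?low \<in> sets (channel n)"
    by (rule sets_low_throughput)
  have "emeasure (channel n) ?low \<le> emeasure (channel n) (few \<union> (?low - few))"
    using few_sets low_sets by (intro emeasure_mono) auto
  also have "\<dots> \<le> emeasure (channel n) few + emeasure (channel n) (?low - few)"
    using few_sets low_sets by (intro emeasure_subadditive) auto
  also have "\<dots> \<le> ennreal (exp (real k - real n * prob {t<..} * (1 - exp (-1))))
      + ennreal (real k * (C * exp (- s * \<theta>)) ^ k)"
    by (intro add_mono few_le interf)
  finally show ?thesis using C by (simp add: ennreal_plus)
qed

section \<open>Logarithmic order for a general fading law\<close>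

text \<open>The two exponential bounds are applied at thresholds \<open>k n\<close> and
  \<open>l n\<close> of logarithmic size; the constants are tuned so that the failure probabilities
  \<open>e1 + e2\<close> and \<open>e3\<close> vanish.\<close>

theorem max_throughput_log:
  assumes nonneg: "AE x in D. 0 \<le> x" and s: "s > 0" and \<beta>: "\<beta> > 0" and N0: "N0 \<ge> 0"
    and C: "(\<integral>\<^sup>+x. ennreal (exp (s * x)) \<partial>D) \<le> ennreal C" "C \<ge> 1"
    and tail: "\<And>t. t \<ge> 1 \<Longrightarrow> K * exp (- b * t) \<le> prob {t<..}" and K: "K > 0" and b: "b > 0"
  shows "\<exists>c1 c2. 0 < c1 \<and> 0 < c2 \<and>
    (\<lambda>n. measure (channel n) {g \<in> space (channel n).
        c1 * ln (real n) \<le> real (max_throughput N0 \<beta> n g) \<and>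
        real (max_throughput N0 \<beta> n g) \<le> c2 * ln (real n)}) \<longlonglongrightarrow> 1"
proof -
  \<comment> \<open>Arises from bounding \<open>exp (- s * \<beta> * x)\<close> by 1 for
    \<open>x \<le> 1\<close> and by \<open>exp (- s * \<beta>)\<close> beyond; \<open>q < 1\<close>
    because \<open>tail\<close> at 1 gives positive mass there.\<close>
  define q where "q = 1 - (1 - exp (- s * \<beta>)) * prob {1<..}"
  have e: "exp (- s * \<beta>) < 1" using s \<beta> by simp
  have "prob {1<..} > 0"
    using tail[of 1] K by (smt (verit) exp_gt_zero mult_pos_pos)
  then have q1: "q < 1" using e by (simp add: q_def)
  have "(1 - exp (- s * \<beta>)) * prob {1<..} \<le> (1 - exp (- s * \<beta>)) * 1"
    using e by (intro mult_left_mono) auto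
  also have "\<dots> < 1" by simp
  finally have q0: "q > 0" by (simp add: q_def)
  have q: "(\<integral>\<^sup>+x. ennreal (exp (- s * \<beta> * x)) \<partial>D) \<le> ennreal q"
  proof -
    have "(\<integral>\<^sup>+x. ennreal (exp (- s * \<beta> * x)) \<partial>D)
        \<le> (\<integral>\<^sup>+x. ennreal (1 - (1 - exp (- s * \<beta>)) * indicator {1<..} x) \<partial>D)"
    proof (rule nn_integral_mono_AE, use nonneg in eventually_elim)
      case (elim x)
      then show ?case
        using s \<beta> by (intro ennreal_leI) (auto simp: indicator_def)
    qed
    also have "\<dots> = ennreal q"
      unfolding q_def by (rule nn_integral_one_minus_indicator) (use e in auto)
    finally show ?thesis .
  qed
  \<comment> \<open>Solves \<open>C * exp (- s * \<theta>) = exp (-1)\<close>.\<close>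
  define \<theta> where "\<theta> = (ln C + 1) / s"
  have \<theta>: "\<theta> > 0" using C s by (simp add: \<theta>_def add_nonneg_pos)
  have C\<theta>: "C * exp (- s * \<theta>) = exp (-1)"
  proof -
    have "- s * \<theta> = - ln C + - 1" using s by (simp add: \<theta>_def)
    then show ?thesis using C by (simp only: exp_add exp_minus exp_ln) simp
  qed
  \<comment> \<open>Makes \<open>\<beta> * \<theta> * c1 * ln n\<close> half of
    \<open>t = ln n / (2 * b)\<close>; the other half absorbs the noise and the rounding of
    \<open>k n\<close>.\<close>
  define c1 where "c1 = 1 / (4 * b * \<beta> * \<theta>)"
  \<comment> \<open>Chosen so that \<open>q powr (c2 * ln n)\<close> is \<open>1 / n ^ 2\<close>,
    beating the factor \<open>n\<close> of the union bound.\<close>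
  define c2 where "c2 = - 2 / ln q"
  have c: "c1 > 0" "c2 > 0"
    using b \<beta> \<theta> q0 q1 by (auto simp: c1_def c2_def zero_less_divide_iff ln_less_zero)
  define \<delta> where "\<delta> = K * (1 - exp (-1))"
  have \<delta>: "\<delta> > 0" using K by (simp add: \<delta>_def)
  define k where "k n = nat \<lceil>c1 * ln (real n)\<rceil>" for n
  \<comment> \<open>With the \<open>+ 1\<close>, throughput below \<open>l n\<close> means at most
    the floor of \<open>c2 * ln n\<close>, and the exponent \<open>l n - 1\<close> is that floor;
    rounding costs one factor \<open>1 / q\<close>.\<close>
  define l where "l n = nat \<lfloor>c2 * ln (real n)\<rfloor> + 1" for n
  define low where "low n = {g \<in> space (channel n). \<forall>S\<subseteq>{..<n}. throughput N0 \<beta> g S < k n}" for n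
  define high where "high n = {g \<in> space (channel n). \<exists>S\<subseteq>{..<n}. l n \<le> throughput N0 \<beta> g S}" for n
  define good where "good n = {g \<in> space (channel n).
        c1 * ln (real n) \<le> real (max_throughput N0 \<beta> n g) \<and>
        real (max_throughput N0 \<beta> n g) \<le> c2 * ln (real n)}" for n
  define e1 where "e1 n = exp (c1 * ln (real n) + 1 - \<delta> * sqrt (real n))" for n :: nat
  define e2 where "e2 n = (c1 * ln (real n) + 1) * exp (- (c1 * ln (real n)))" for n :: nat
  define e3 where "e3 n = C / q / real n" for n :: nat
  have ln0: "ln (real n) \<ge> 0" if "n \<ge> 1" for n using that by simp
  have low_le: "\<forall>\<^sub>F n in sequentially. measure (channel n) (low n) \<le> e1 n + e2 n"
  proof -
    have "\<forall>\<^sub>F n :: nat in sequentially. 1 \<le> ln (real n) / (2 * b)" using b by real_asymp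
    moreover have "\<forall>\<^sub>F n :: nat in sequentially. \<beta> * N0 + \<beta> * \<theta> \<le> ln (real n) / (4 * b)"
      using b by real_asymp
    ultimately show ?thesis using eventually_ge_at_top[of "1::nat"]
    proof eventually_elim
      case (elim n)
      \<comment> \<open>At this level \<open>exp (- b * t)\<close> is \<open>1 / sqrt n\<close>, so
        the expected number of strong links is at least \<open>K * sqrt n\<close>.\<close>
      define t where "t = ln (real n) / (2 * b)"
      have k: "c1 * ln (real n) \<le> real (k n)" "real (k n) \<le> c1 * ln (real n) + 1"
        using c ln0[of n] elim by (auto simp: k_def)
      have "\<beta> * \<theta> * real (k n) \<le> \<beta> * \<theta> * (c1 * ln (real n) + 1)"
        using k \<beta> \<theta> by (intro mult_left_mono) auto
      also have "\<dots> = ln (real n) / (4 * b) + \<beta> * \<theta>"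
        using \<beta> \<theta> b by (simp add: c1_def field_simps)
      finally have t: "\<beta> * (N0 + \<theta> * real (k n)) \<le> t"
        using elim b by (simp add: t_def algebra_simps)
      have "exp (- b * t) = 1 / sqrt (real n)"
      proof -
        have "exp (- b * t) = real n powr (- (1 / 2))"
          using b elim by (simp add: t_def powr_def)
        also have "\<dots> = 1 / sqrt (real n)" by (simp add: powr_minus powr_half_sqrt field_simps)
        finally show ?thesis .
      qed
      then have "K / sqrt (real n) \<le> prob {t<..}" using tail[of t] elim by (simp add: t_def)
      then have "real n * (K / sqrt (real n)) * (1 - exp (-1)) \<le> real n * prob {t<..} * (1 - exp (-1))"
        by (intro mult_right_mono mult_left_mono) auto
      also have "real n * (K / sqrt (real n)) * (1 - exp (-1)) = \<delta> * sqrt (real n)"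
      proof -
        have "real n * (K / sqrt (real n)) * (1 - exp (-1)) = \<delta> * (real n / sqrt (real n))"
          by (simp add: \<delta>_def)
        then show ?thesis by (simp only: real_div_sqrt of_nat_0_le_iff)
      qed
      finally have 1: "exp (real (k n) - real n * prob {t<..} * (1 - exp (-1))) \<le> e1 n"
        using k by (simp add: e1_def)
      have "real (k n) * (C * exp (- s * \<theta>)) ^ k n = real (k n) * exp (- real (k n))"
        unfolding C\<theta> by (simp add: exp_of_nat_mult[symmetric])
      also have "\<dots> \<le> e2 n" unfolding e2_def using k c ln0[of n] elim by (intro mult_mono) auto
      finally have 2: "real (k n) * (C * exp (- s * \<theta>)) ^ k n \<le> e2 n" .
      have "emeasure (channel n) (low n) \<le> ennreal (e1 n + e2 n)"
        unfolding low_def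
        by (rule order_trans[OF emeasure_small_throughput_le[OF s \<beta> C t]]) (intro ennreal_leI add_mono 1 2)
      moreover have "e1 n + e2 n \<ge> 0" using c ln0[of n] elim by (simp add: e1_def e2_def)
      ultimately show ?case
        by (simp add: finite_measure.emeasure_eq_measure prob_space.finite_measure[OF prob_space_channel])
    qed
  qed
  have high_le: "\<forall>\<^sub>F n in sequentially. measure (channel n) (high n) \<le> e3 n"
  proof -
    have "\<forall>\<^sub>F n :: nat in sequentially. C / q / real n \<le> 1" by real_asymp
    then show ?thesis using eventually_ge_at_top[of "1::nat"]
    proof eventually_elim
      case (elim n)
      define x where "x = real n * C * q ^ (l n - 1)"
      have x0: "x \<ge> 0" using C q0 by (simp add: x_def)
      have "q ^ (l n - 1) = q powr real (nat \<lfloor>c2 * ln (real n)\<rfloor>)"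
        using q0 by (simp add: l_def powr_realpow)
      also have "\<dots> \<le> q powr (c2 * ln (real n) - 1)"
        using q0 q1 by (intro powr_mono') linarith+
      also have "\<dots> = exp (- 2 * ln (real n)) / q"
        using q0 q1 by (simp add: powr_diff) (simp add: powr_def c2_def)
      also have "exp (- 2 * ln (real n)) = 1 / (real n * real n)"
        using elim by (simp add: exp_minus exp_double field_simps power2_eq_square)
      finally have "x \<le> real n * C * (1 / (real n * real n) / q)"
        unfolding x_def using C by (intro mult_left_mono) auto
      also have "\<dots> = e3 n" using elim q0 by (simp add: e3_def field_simps)
      finally have xe: "x \<le> e3 n" .
      \<comment> \<open>As \<open>x \<le> 1\<close> and \<open>l n \<ge> 1\<close>, a single factor
        of the power already suffices.\<close>
      then have "x ^ l n \<le> x ^ 1" using x0 elim by (intro power_decreasing) (auto simp: l_def e3_def)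
      then have "emeasure (channel n) (high n) \<le> ennreal (e3 n)"
        unfolding high_def using xe emeasure_large_throughput_le[OF nonneg s \<beta> N0 C(1) _ q, of n "l n"] C q0
        by (auto simp: x_def intro: order_trans ennreal_leI)
      moreover have "e3 n \<ge> 0" using xe x0 by linarith
      ultimately show ?case
        by (simp add: finite_measure.emeasure_eq_measure prob_space.finite_measure[OF prob_space_channel])
    qed
  qed
  have good_ge: "1 - measure (channel n) (low n) - measure (channel n) (high n) \<le> measure (channel n) (good n)"
    if n: "n \<ge> 1" for n
  proof -
    interpret P: prob_space "channel n" by (rule prob_space_channel)
    have sets: "low n \<in> sets (channel n)" "high n \<in> sets (channel n)" "good n \<in> sets (channel n)"
      by (simp_all add: low_def high_def good_def)
    have "space (channel n) \<subseteq> low n \<union> high n \<union> good n"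
    proof
      fix g assume g: "g \<in> space (channel n)"
      show "g \<in> low n \<union> high n \<union> good n"
      proof (cases "g \<in> low n \<or> g \<in> high n")
        case False
        then obtain S where S: "S \<subseteq> {..<n}" "k n \<le> throughput N0 \<beta> g S"
          using g by (auto simp: low_def not_less)
        have "throughput N0 \<beta> g S \<le> max_throughput N0 \<beta> n g"
          using S unfolding max_throughput_def by (intro Max_ge) auto
        then have 1: "c1 * ln (real n) \<le> real (max_throughput N0 \<beta> n g)"
          using S unfolding k_def by linarith
        have "max_throughput N0 \<beta> n g \<in> throughput N0 \<beta> g ` Pow {..<n}"
          unfolding max_throughput_def by (intro Max_in) auto
        then have "max_throughput N0 \<beta> n g < l n"
          using False g by (auto simp: high_def not_le)
        then have "real (max_throughput N0 \<beta> n g) \<le> real (nat \<lfloor>c2 * ln (real n)\<rfloor>)"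
          by (simp add: l_def)
        also have "\<dots> \<le> c2 * ln (real n)" using c ln0[OF n] by simp
        finally show ?thesis using 1 g by (simp add: good_def)
      qed auto
    qed
    then have "1 \<le> measure (channel n) (low n \<union> high n \<union> good n)"
      using sets P.prob_space P.finite_measure_mono[of "space (channel n)" "low n \<union> high n \<union> good n"] by simp
    also have "\<dots> \<le> measure (channel n) (low n) + measure (channel n) (high n) + measure (channel n) (good n)"
      using sets measure_Un_le[of "low n \<union> high n" "channel n" "good n"]
        measure_Un_le[of "low n" "channel n" "high n"] by simp
    finally show ?thesis by simp
  qed
  have "(\<lambda>n. measure (channel n) (good n)) \<longlonglongrightarrow> 1"
  proof (rule tendsto_sandwich)
    show "\<forall>\<^sub>F n in sequentially. 1 - (e1 n + e2 n) - e3 n \<le> measure (channel n) (good n)"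
      using low_le high_le eventually_ge_at_top[of "1::nat"]
      by eventually_elim (use good_ge in force)
    show "\<forall>\<^sub>F n in sequentially. measure (channel n) (good n) \<le> 1"
      by (simp add: prob_space.prob_le_1[OF prob_space_channel])
    have "e1 \<longlonglongrightarrow> 0" unfolding e1_def using \<delta> c by real_asymp
    moreover have "e2 \<longlonglongrightarrow> 0" unfolding e2_def using c by real_asymp
    moreover have "e3 \<longlonglongrightarrow> 0" unfolding e3_def by real_asymp
    ultimately have "(\<lambda>n. 1 - (e1 n + e2 n) - e3 n) \<longlonglongrightarrow> 1 - (0 + 0) - 0"
      by (intro tendsto_intros)
    then show "(\<lambda>n. 1 - (e1 n + e2 n) - e3 n) \<longlonglongrightarrow> 1" by simp
  qed simp
  then show ?thesis using c unfolding good_def by blast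
qed

end

section \<open>Normalisation, exponential moment and tail of the Gamma law\<close>

text \<open>Rescaling by the rate \<open>r = m / \<Omega>\<close> reduces the integral to Euler's
  integral for \<open>Gamma m\<close>.\<close>

lemma gamma_pdf_nn_integral:
  assumes "m > 0" "\<Omega> > 0"
  shows "(\<integral>\<^sup>+x. ennreal (gamma_pdf m \<Omega> x) \<partial>lborel) = 1"
proof -
  define r where "r = m / \<Omega>"
  have r: "r > 0" using assms by (simp add: r_def)
  have G: "Gamma m > 0" using assms by simp
  let ?f = "\<lambda>t. ennreal (indicator {0..} t * t powr (m - 1) / exp t)"
  have *: "ennreal (gamma_pdf m \<Omega> x) = ennreal (r / Gamma m) * ?f (r * x)" for x
  proof -
    have 1: "(\<Omega> / m) powr m = 1 / (r powr (m - 1) * r)"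
      using assms r by (simp add: r_def powr_divide powr_diff field_simps)
    have 2: "- m * x / \<Omega> = - (r * x)" by (simp add: r_def)
    have "gamma_pdf m \<Omega> x =
        r / Gamma m * (indicator {0..} (r * x) * (r * x) powr (m - 1) / exp (r * x))"
      using r G unfolding gamma_pdf_def 1 2
      by (auto simp: powr_mult zero_le_mult_iff exp_minus field_simps indicator_def)
    then show ?thesis using r G by (simp add: ennreal_mult'[symmetric] indicator_def)
  qed
  have "ennreal (Gamma m) = (\<integral>\<^sup>+t. ?f t \<partial>lborel)"
    by (rule Gamma_conv_nn_integral_real) fact
  also have "\<dots> = ennreal r * (\<integral>\<^sup>+x. ?f (r * x) \<partial>lborel)"
    using r by (subst nn_integral_real_affine[of _ r 0]) auto
  finally have "ennreal (1 / Gamma m) * ennreal (Gamma m) = ennreal (1 / Gamma m) * (ennreal r * (\<integral>\<^sup>+x. ?f (r * x) \<partial>lborel))"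
    by simp
  also have "\<dots> = (\<integral>\<^sup>+x. ennreal (gamma_pdf m \<Omega> x) \<partial>lborel)"
    using r G unfolding * by (subst nn_integral_cmult) (auto simp: mult.assoc[symmetric] ennreal_mult'[symmetric])
  finally show ?thesis using G by (simp add: ennreal_mult'[symmetric] flip: ennreal_1)
qed

lemma sets_gamma_measure [measurable_cong]: "sets (gamma_measure m \<Omega>) = sets borel"
  by (simp add: gamma_measure_def)

lemma borel_measurable_gamma_pdf [measurable]: "gamma_pdf m \<Omega> \<in> borel_measurable borel"
  unfolding gamma_pdf_def by measurable

lemma prob_space_gamma_measure:
  assumes "m > 0" "\<Omega> > 0"
  shows "prob_space (gamma_measure m \<Omega>)"
  using gamma_pdf_nn_integral[OF assms]
  by (intro prob_spaceI) (simp add: gamma_measure_def emeasure_density)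

lemma AE_gamma_measure_nonneg: "AE x in gamma_measure m \<Omega>. 0 \<le> x"
  unfolding gamma_measure_def by (subst AE_density) (auto simp: gamma_pdf_def)

text \<open>Tilting by half the rate \<open>m / \<Omega>\<close> yields the density with
  \<open>\<Omega>\<close> doubled, up to the ratio \<open>2 powr m\<close> of normalising
  constants.\<close>

lemma gamma_measure_exp_moment:
  assumes "m > 0" "\<Omega> > 0"
  shows "(\<integral>\<^sup>+x. ennreal (exp (m / (2 * \<Omega>) * x)) \<partial>gamma_measure m \<Omega>) = ennreal (2 powr m)"
proof -
  have "gamma_pdf m \<Omega> x * exp (m / (2 * \<Omega>) * x) = 2 powr m * gamma_pdf m (2 * \<Omega>) x" for x
  proof -
    have "exp (- (m * x / \<Omega>)) * exp (m / (2 * \<Omega>) * x) = exp (- (m * x / (2 * \<Omega>)))"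
      using assms by (simp add: exp_add[symmetric] field_simps)
    moreover have "(2 * \<Omega> / m) powr m = 2 powr m * (\<Omega> / m) powr m"
      using assms powr_mult[of 2 "\<Omega> / m" m] by simp
    ultimately show ?thesis by (simp add: gamma_pdf_def)
  qed
  then have "(\<integral>\<^sup>+x. ennreal (exp (m / (2 * \<Omega>) * x)) \<partial>gamma_measure m \<Omega>)
      = (\<integral>\<^sup>+x. ennreal (2 powr m) * ennreal (gamma_pdf m (2 * \<Omega>) x) \<partial>lborel)"
    unfolding gamma_measure_def
    by (subst nn_integral_density) (auto simp flip: ennreal_mult'' ennreal_mult')
  then show ?thesis
    using gamma_pdf_nn_integral[of m "2 * \<Omega>"] assms by (simp add: nn_integral_cmult)
qed

text \<open>The density is bounded below on the unit interval \<open>{t<..t + 1}\<close>. The extra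
  1 in the decay rate pays for the power factor, which may decrease when
  \<open>m < 1\<close>.\<close>

lemma gamma_measure_tail_ge:
  assumes "m > 0" "\<Omega> > 0" "t \<ge> 1"
  shows "exp (- m / \<Omega>) / (Gamma m * (\<Omega> / m) powr m) * exp (- (m / \<Omega> + 1) * t)
           \<le> measure (gamma_measure m \<Omega>) {t<..}" (is "?c \<le> _")
proof -
  interpret prob_space "gamma_measure m \<Omega>" by (rule prob_space_gamma_measure) fact+
  have pdf: "?c \<le> gamma_pdf m \<Omega> x" if x: "t < x" "x \<le> t + 1" for x
  proof -
    have "x \<le> exp t" using x exp_ge_add_one_self[of t] by linarith
    then have "exp (- t) \<le> x powr (-1)" using x assms by (simp add: exp_minus powr_minus field_simps)
    \<comment> \<open>Holds for every \<open>m > 0\<close>, as \<open>x > 1\<close> and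
      \<open>m - 1 \<ge> -1\<close>.\<close>
    also have "\<dots> \<le> x powr (m - 1)" using x assms by (intro powr_mono) auto
    finally have 1: "exp (- t) \<le> x powr (m - 1)" .
    have "m * x / \<Omega> \<le> m * (t + 1) / \<Omega>" using x assms by (intro divide_right_mono mult_left_mono) auto
    then have 2: "exp (- (m * (t + 1) / \<Omega>)) \<le> exp (- (m * x / \<Omega>))" by simp
    have "exp (- m / \<Omega>) * exp (- (m / \<Omega> + 1) * t) = exp (- t) * exp (- (m * (t + 1) / \<Omega>))"
      by (simp add: exp_add[symmetric] algebra_simps add_divide_distrib)
    also have "\<dots> \<le> x powr (m - 1) * exp (- (m * x / \<Omega>))" using 1 2 by (intro mult_mono) auto
    finally show ?thesis
      using x assms Gamma_real_pos[of m] by (simp add: gamma_pdf_def divide_right_mono)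
  qed
  have "ennreal ?c = (\<integral>\<^sup>+x. ennreal ?c * indicator {t<..t + 1} x \<partial>lborel)"
    by (simp add: nn_integral_cmult_indicator)
  also have "\<dots> \<le> (\<integral>\<^sup>+x. ennreal (gamma_pdf m \<Omega> x) * indicator {t<..} x \<partial>lborel)"
    using pdf by (intro nn_integral_mono) (auto simp: indicator_def intro!: ennreal_leI)
  also have "\<dots> = emeasure (gamma_measure m \<Omega>) {t<..}"
    by (simp add: gamma_measure_def emeasure_density)
  finally show ?thesis by (simp add: emeasure_eq_measure)
qed

theorem corollary5:
  fixes m \<Omega> N0 \<beta> :: real
  assumes "m > 0" and "\<Omega> > 0" and "N0 \<ge> 0" and "\<beta> > 0"
  shows "\<exists>c1 c2. 0 < c1 \<and> 0 < c2 \<and>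
    (\<lambda>n. measure (channel_measure m \<Omega> n)
        {g \<in> space (channel_measure m \<Omega> n).
           c1 * ln (real n) \<le> real (max_throughput N0 \<beta> n g) \<and>
           real (max_throughput N0 \<beta> n g) \<le> c2 * ln (real n)})
    \<longlonglongrightarrow> 1"
proof -
  interpret iid_channel "gamma_measure m \<Omega>"
    using prob_space_gamma_measure[OF assms(1,2)] sets_gamma_measure
    by (simp add: iid_channel_def iid_channel_axioms_def)
  have "(\<integral>\<^sup>+x. ennreal (exp (m / (2 * \<Omega>) * x)) \<partial>gamma_measure m \<Omega>) \<le> ennreal (2 powr m)"
    using gamma_measure_exp_moment[OF assms(1,2)] by (rule eq_refl)
  moreover have "2 powr m \<ge> 1" using assms by (simp add: ge_one_powr_ge_zero)
  ultimately show ?thesis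
    unfolding channel_measure_def using assms
    by (intro max_throughput_log[OF AE_gamma_measure_nonneg, where s = "m / (2 * \<Omega>)" and C = "2 powr m"
          and K = "exp (- m / \<Omega>) / (Gamma m * (\<Omega> / m) powr m)" and b = "m / \<Omega> + 1"]
        gamma_measure_tail_ge) (auto simp: Gamma_real_pos add_pos_pos)
qed

end
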